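(* Let $\mathcal{X}\subset\mathbb{R}^n$ be a compact convex set, let $f$ be convex (possibly nonsmooth), let $x^*\in\operatorname{argmin}_{x\in\mathcal{X}}f(x)$, let $R>0$ be such that $\mathcal{X}\subset B(x^*,R)$, and let $L>0$ be such that for every $x\in\mathcal{X}$ the subdifferential $\partial f(x)$ is nonempty and $\|g\|\le L$ for every $g\in\partial f(x)$. Let $(\eta_s)_{s\ge1}$ be a positive, non-increasing sequence of step-sizes, and let $(x_s)_{s\ge1}$ be any sequence of iterates of the projected subgradient method started at a point $x_1\in\mathcal{X}$ with these step-sizes. Then for every fixed real number $k\ge-1$ and every integer $t\ge1$, $$f\left(\frac{\sum_{s=1}^t \frac{1}{\eta_s^k}x_s}{\sum_{s=1}^t \frac{1}{\eta_s^k}}\right)-f(x^* )\le \frac{\frac{R^2}{\eta_t^{k+1}}+ L^2 \sum_{s=1}^t\frac{1}{\eta_s^{k-1}}}{2\sum_{s=1}^t\frac{1}{\eta_s^k}}.$$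
   Context: $\|\cdot\|$ is the Euclidean norm on $\mathbb{R}^n$ and $B(x^*,R)$ is the closed Euclidean ball of radius $R$ centered at $x^*$. The function $f$ is a real-valued convex function defined on a convex set $D\subset\mathbb{R}^n$ containing $\mathcal{X}$ (e.g. $D=\mathbb{R}^n$), and $\partial f(x)=\{g\in\mathbb{R}^n: f(y)\ge f(x)+g^T(y-x)\ \text{for all } y\in D\}$ is its subdifferential at $x$. The projected subgradient method with positive step-sizes $(\eta_s)_{s\ge1}$, started at $x_1\in\mathcal{X}$, generates, for $s\ge1$, $$y_{s+1}=x_s-\eta_s g_s,\quad\text{where } g_s\in\partial f(x_s)\text{ is arbitrary},\qquad x_{s+1}=\operatorname{argmin}_{x\in\mathcal{X}}\|x-y_{s+1}\|.$$ Here $\eta_s^k$ denotes the $k$-th power of $\eta_s$. *)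

theory Defs
  imports "HOL-Analysis.Analysis"
begin

(* Only the values of f on D matter; f is total because functions in HOL are. *)
definition subdifferential ::
    "(real ^ 'n) set \<Rightarrow> (real ^ 'n \<Rightarrow> real) \<Rightarrow> real ^ 'n \<Rightarrow> (real ^ 'n) set" where
  "subdifferential D f x = {g. \<forall>y\<in>D. f y \<ge> f x + g \<bullet> (y - x)}"

(* Sequences are indexed from 1; the values at index 0 are irrelevant.  The subgradient at
   each step is an arbitrary element of the subdifferential, so this is a predicate on
   sequences of iterates rather than a function computing them. *)
definition projected_subgradient_iterates ::
    "(real ^ 'n) set \<Rightarrow> (real ^ 'n) set \<Rightarrow> (real ^ 'n \<Rightarrow> real) \<Rightarrow> (nat \<Rightarrow> real)
      \<Rightarrow> (nat \<Rightarrow> real ^ 'n) \<Rightarrow> bool" where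
  "projected_subgradient_iterates X D f \<eta> x \<longleftrightarrow>
     x 1 \<in> X \<and>
     (\<forall>s\<ge>1. \<exists>g \<in> subdifferential D f (x s). \<exists>y.
        y = x s - \<eta> s *\<^sub>R g \<and>
        is_arg_min (\<lambda>z. norm (z - y)) (\<lambda>z. z \<in> X) (x (s + 1)))"

end

theory Submission
  imports Defs
begin

text \<open>Expanding the squared distance to \<open>xstar\<close> in one projected step bounds
  \<open>2 * \<eta> s * (f (x s) - f xstar)\<close> by a decrease of that squared distance plus
  \<open>(\<eta> s * L)\<^sup>2\<close>. Dividing by \<open>\<eta> s powr (k + 1)\<close>, whose reciprocal is non-decreasing because
  \<open>k \<ge> -1\<close>, lets the sum over \<open>s\<close> collapse by Abel summation; Jensen's inequality then
  passes to the weighted average of the iterates.\<close>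

text \<open>The segments from the projection \<open>p\<close> to \<open>y\<close> and to
  \<open>u\<close> meet at an angle of at least 90 degrees. Expanding the squared distance from
  \<open>y\<close> to \<open>u\<close> around \<open>p\<close> therefore adds only nonnegative terms
  to that from \<open>p\<close> to \<open>u\<close>.\<close>

lemma dist_argmin_le:
  fixes X :: "'a::euclidean_space set"
  assumes "convex X" "closed X" "is_arg_min (\<lambda>z. norm (z - y)) (\<lambda>z. z \<in> X) p" "u \<in> X"
  shows "dist p u \<le> dist y u"
proof -
  have "p \<in> X" and min: "\<forall>z\<in>X. dist y p \<le> dist y z"
    using assms(3) by (auto simp: is_arg_min_linorder dist_norm norm_minus_commute)
  then have "(y - p) \<bullet> (u - p) \<le> 0"
    using any_closest_point_dot assms by blast
  moreover have "(dist y u)\<^sup>2 = (dist p u)\<^sup>2 + (dist y p)\<^sup>2 - 2 * ((y - p) \<bullet> (u - p))"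
    unfolding dist_norm power2_norm_eq_inner
    by (simp add: inner_diff_left inner_diff_right inner_commute algebra_simps)
  ultimately have "(dist p u)\<^sup>2 \<le> (dist y u)\<^sup>2"
    using zero_le_power2[of "dist y p"] by linarith
  then show ?thesis
    by (rule power2_le_imp_le) simp
qed

text \<open>Projecting onto \<open>X\<close> moves the point no farther from \<open>u\<close>, so it
  suffices to expand the square for the unprojected step. Its cross term is controlled by the
  subgradient inequality tested at \<open>u\<close>, its quadratic term by \<open>L\<close>.\<close>

lemma projected_subgradient_step:
  fixes X D :: "(real ^ 'n) set"
  assumes "convex X" "closed X" "u \<in> X" "u \<in> D" "\<eta> > 0"
    and g: "g \<in> subdifferential D f x" "norm g \<le> L"
    and p: "is_arg_min (\<lambda>z. norm (z - (x - \<eta> *\<^sub>R g))) (\<lambda>z. z \<in> X) p"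
  shows "2 * \<eta> * (f x - f u) \<le> (dist x u)\<^sup>2 - (dist p u)\<^sup>2 + \<eta>\<^sup>2 * L\<^sup>2"
proof -
  have "(dist p u)\<^sup>2 \<le> (dist (x - \<eta> *\<^sub>R g) u)\<^sup>2"
    using dist_argmin_le[OF assms(1,2) p assms(3)] by (simp add: power_mono)
  also have "\<dots> = (dist x u)\<^sup>2 + 2 * \<eta> * (g \<bullet> (u - x)) + \<eta>\<^sup>2 * (norm g)\<^sup>2"
    unfolding dist_norm power2_norm_eq_inner
    by (simp add: inner_diff_left inner_diff_right inner_commute algebra_simps power2_eq_square)
  also have "\<dots> \<le> (dist x u)\<^sup>2 + 2 * \<eta> * (f u - f x) + \<eta>\<^sup>2 * L\<^sup>2"
  proof -
    have "g \<bullet> (u - x) \<le> f u - f x"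
      using g(1) \<open>u \<in> D\<close> by (auto simp: subdifferential_def algebra_simps)
    moreover have "(norm g)\<^sup>2 \<le> L\<^sup>2"
      using g(2) by (simp add: power_mono)
    ultimately show ?thesis
      using \<open>\<eta> > 0\<close> by (intro add_mono mult_left_mono) auto
  qed
  finally show ?thesis
    by (simp add: algebra_simps)
qed

text \<open>With constant weights the sum telescopes; growing weights cost at most what the upper
  bound \<open>M\<close> allows. Keeping \<open>- a (Suc t)\<close> on the right is what lets the
  induction close.\<close>

lemma sum_weighted_differences_le:
  fixes w a :: "nat \<Rightarrow> real"
  assumes "t \<ge> 1"
    and mono: "\<And>s. s \<ge> 1 \<Longrightarrow> w s \<le> w (Suc s)" and pos: "\<And>s. s \<ge> 1 \<Longrightarrow> 0 \<le> w s"
    and bound: "\<And>s. s \<ge> 1 \<Longrightarrow> a s \<le> M"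
  shows "(\<Sum>s=1..t. w s * (a s - a (Suc s))) \<le> w t * (M - a (Suc t))"
  using \<open>t \<ge> 1\<close>
proof (induction t rule: dec_induct)
  case base
  show ?case
    using pos[of 1] bound[of 1] by (simp add: mult_left_mono)
next
  case (step n)
  \<comment> \<open>Since \<open>M - a (Suc n)\<close> is nonnegative, the weight may be raised to
    \<open>w (Suc n)\<close>; adding the next summand then cancels \<open>a (Suc n)\<close>
    exactly.\<close>
  have "w n * (M - a (Suc n)) \<le> w (Suc n) * (M - a (Suc n))"
    using mono[of n] bound[of "Suc n"] step(1) by (intro mult_right_mono) auto
  then show ?case
    using step by (simp add: algebra_simps)
qed

theorem theorem2:
  fixes X D :: "(real ^ 'n) set"
    and f :: "real ^ 'n \<Rightarrow> real"
    and xstar :: "real ^ 'n"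
    and R L k :: real
    and \<eta> :: "nat \<Rightarrow> real"
    and x :: "nat \<Rightarrow> real ^ 'n"
    and t :: nat
  assumes "compact X" and "convex X"
    and "X \<subseteq> D" and "convex D" and "convex_on D f"
    and "is_arg_min f (\<lambda>z. z \<in> X) xstar"
    and "R > 0" and "X \<subseteq> cball xstar R"
    and "L > 0"
    and "\<And>z. z \<in> X \<Longrightarrow> subdifferential D f z \<noteq> {}"
    and "\<And>z g. z \<in> X \<Longrightarrow> g \<in> subdifferential D f z \<Longrightarrow> norm g \<le> L"
    and "\<And>s. s \<ge> 1 \<Longrightarrow> \<eta> s > 0"
    and "\<And>s s'. 1 \<le> s \<Longrightarrow> s \<le> s' \<Longrightarrow> \<eta> s' \<le> \<eta> s"
    and "projected_subgradient_iterates X D f \<eta> x"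
    and "k \<ge> -1" and "t \<ge> 1"
  shows "f ((\<Sum>s=1..t. (1 / \<eta> s powr k) *\<^sub>R x s) /\<^sub>R (\<Sum>s=1..t. 1 / \<eta> s powr k)) - f xstar
    \<le> (R\<^sup>2 / \<eta> t powr (k + 1) + L\<^sup>2 * (\<Sum>s=1..t. 1 / \<eta> s powr (k - 1)))
        / (2 * (\<Sum>s=1..t. 1 / \<eta> s powr k))"
proof -
  define w where "w s = 1 / \<eta> s powr k" for s
  \<comment> \<open>Multiplying the one-step bound by \<open>v s\<close> turns its factor
    \<open>\<eta> s\<close> into the averaging weight \<open>w s\<close> and the square of
    \<open>\<eta> s\<close> into \<open>1 / \<eta> s powr (k - 1)\<close>.\<close>
  define v where "v s = 1 / \<eta> s powr (k + 1)" for s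
  define W where "W = (\<Sum>s=1..t. w s)"
  define a where "a s = (dist (x s) xstar)\<^sup>2" for s
  have w_pos: "w s > 0" if "s \<ge> 1" for s
    using assms(12)[OF that] by (simp add: w_def)
  have W_pos: "W > 0"
    unfolding W_def using w_pos \<open>t \<ge> 1\<close> by (intro sum_pos) auto
  have "closed X"
    using \<open>compact X\<close> by (rule compact_imp_closed)
  have xstar: "xstar \<in> X"
    using assms(6) by (simp add: is_arg_min_linorder)
  have x1: "x 1 \<in> X" and iter: "\<And>s. s \<ge> 1 \<Longrightarrow> \<exists>g \<in> subdifferential D f (x s).
      is_arg_min (\<lambda>z. norm (z - (x s - \<eta> s *\<^sub>R g))) (\<lambda>z. z \<in> X) (x (Suc s))"
    using assms(14) by (auto simp: projected_subgradient_iterates_def)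
  \<comment> \<open>Membership in \<open>X\<close> makes both the bound \<open>L\<close> on
    subgradients and the radius \<open>R\<close> available at every iterate, including the one after
    step \<open>t\<close>.\<close>
  have x_in: "x s \<in> X" if "s \<ge> 1" for s
    using that
  proof (induction s rule: dec_induct)
    case (step n)
    then show ?case
      using iter[of n] by (auto simp: is_arg_min_linorder)
  qed (rule x1)
  have a_le: "a s \<le> R\<^sup>2" if "s \<ge> 1" for s
    using x_in[OF that] assms(8) by (auto simp: a_def dist_commute intro!: power_mono)
  \<comment> \<open>The exponent \<open>k + 1\<close> is nonnegative, so smaller step-sizes have
    smaller powers and larger reciprocals.\<close>
  have v_mono: "v s \<le> v (Suc s)" if "s \<ge> 1" for s
    using assms(12)[of "Suc s"] assms(12)[OF that] assms(13)[of s "Suc s"] that \<open>k \<ge> -1\<close>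
    by (auto simp: v_def intro!: divide_left_mono powr_mono2)
  have step: "2 * (w s * (f (x s) - f xstar)) \<le> v s * (a s - a (Suc s)) + L\<^sup>2 * (1 / \<eta> s powr (k - 1))"
    if s: "s \<ge> 1" for s
  proof -
    note \<eta>_pos = assms(12)[OF s]
    obtain g where g: "g \<in> subdifferential D f (x s)"
      "is_arg_min (\<lambda>z. norm (z - (x s - \<eta> s *\<^sub>R g))) (\<lambda>z. z \<in> X) (x (Suc s))"
      using iter[OF s] by blast
    have "2 * \<eta> s * (f (x s) - f xstar) \<le> a s - a (Suc s) + (\<eta> s)\<^sup>2 * L\<^sup>2"
      unfolding a_def
      using projected_subgradient_step[OF assms(2) \<open>closed X\<close> xstar _ \<eta>_pos g(1) _ g(2)]
        xstar assms(3) assms(11)[OF x_in[OF s] g(1)] by blast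
    then have "v s * (2 * \<eta> s * (f (x s) - f xstar)) \<le> v s * (a s - a (Suc s) + (\<eta> s)\<^sup>2 * L\<^sup>2)"
      using \<eta>_pos by (intro mult_left_mono) (auto simp: v_def)
    then have "2 * (v s * \<eta> s * (f (x s) - f xstar)) \<le> v s * (a s - a (Suc s)) + L\<^sup>2 * (v s * (\<eta> s)\<^sup>2)"
      by (simp add: algebra_simps)
    moreover have "v s * \<eta> s = w s"
      using \<eta>_pos by (simp add: v_def w_def powr_add)
    moreover have "v s * (\<eta> s)\<^sup>2 = 1 / \<eta> s powr (k - 1)"
      using \<eta>_pos by (simp add: v_def powr_add powr_diff power2_eq_square field_simps)
    ultimately show ?thesis
      by (simp only:)
  qed
  \<comment> \<open>Dividing by \<open>W\<close> makes the weights sum to 1, as Jensen's inequality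
    requires.\<close>
  have "f ((\<Sum>s=1..t. w s *\<^sub>R x s) /\<^sub>R W) = f (\<Sum>s=1..t. (w s / W) *\<^sub>R x s)"
    by (simp add: scaleR_sum_right divide_inverse mult.commute)
  also have "\<dots> \<le> (\<Sum>s=1..t. (w s / W) * f (x s))"
    using assms(3,5) \<open>t \<ge> 1\<close> W_pos w_pos x_in
    by (intro convex_on_sum[of _ D])
       (auto simp: W_def sum_divide_distrib[symmetric] less_imp_le)
  finally have "f ((\<Sum>s=1..t. w s *\<^sub>R x s) /\<^sub>R W) - f xstar
      \<le> (\<Sum>s=1..t. (w s / W) * f (x s)) - f xstar"
    by simp
  \<comment> \<open>As the \<open>w s\<close> sum to \<open>W\<close>, the constant
    \<open>f xstar\<close> can be distributed over the summands.\<close>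
  also have "\<dots> = (\<Sum>s=1..t. 2 * (w s * (f (x s) - f xstar))) / (2 * W)"
  proof -
    have "(\<Sum>s=1..t. 2 * (w s * (f (x s) - f xstar))) = 2 * ((\<Sum>s=1..t. w s * f (x s)) - W * f xstar)"
      by (simp add: W_def sum_distrib_left sum_distrib_right sum_subtractf right_diff_distrib)
    then show ?thesis
      using W_pos by (simp add: diff_divide_distrib sum_divide_distrib)
  qed
  also have "\<dots> \<le> (R\<^sup>2 / \<eta> t powr (k + 1) + L\<^sup>2 * (\<Sum>s=1..t. 1 / \<eta> s powr (k - 1))) / (2 * W)"
  proof (rule divide_right_mono)
    have "(\<Sum>s=1..t. 2 * (w s * (f (x s) - f xstar)))
        \<le> (\<Sum>s=1..t. v s * (a s - a (Suc s)) + L\<^sup>2 * (1 / \<eta> s powr (k - 1)))"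
      using step by (intro sum_mono) auto
    also have "\<dots> = (\<Sum>s=1..t. v s * (a s - a (Suc s))) + L\<^sup>2 * (\<Sum>s=1..t. 1 / \<eta> s powr (k - 1))"
      by (simp add: sum.distrib sum_distrib_left)
    also have "(\<Sum>s=1..t. v s * (a s - a (Suc s))) \<le> v t * (R\<^sup>2 - a (Suc t))"
      using \<open>t \<ge> 1\<close> v_mono a_le by (intro sum_weighted_differences_le) (auto simp: v_def)
    \<comment> \<open>The final squared distance \<open>a (Suc t)\<close> enters with a minus sign
      and is dropped.\<close>
    also have "\<dots> \<le> R\<^sup>2 / \<eta> t powr (k + 1)"
      by (simp add: v_def a_def divide_right_mono)
    finally show "(\<Sum>s=1..t. 2 * (w s * (f (x s) - f xstar)))
        \<le> R\<^sup>2 / \<eta> t powr (k + 1) + L\<^sup>2 * (\<Sum>s=1..t. 1 / \<eta> s powr (k - 1))"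
      by simp
  qed (use W_pos in simp)
  finally show ?thesis
    by (simp only: w_def W_def)
qed

end
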